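(* Let $\varphi:\mathbb{D}\to\mathbb{D}$ be holomorphic, $\varphi\notin\mathrm{Aut}(\mathbb{D})$, and suppose there is $\alpha\in\mathbb{D}$ with $\varphi(\alpha)=\alpha$ and $0<|\varphi'(\alpha)|<1$. Then the spectrum of the composition operator $C_\varphi:\mathrm{Hol}(\mathbb{D})\to\mathrm{Hol}(\mathbb{D})$, $C_\varphi f=f\circ\varphi$, is $$\sigma(C_\varphi)=\{0\}\cup\{\varphi'(\alpha)^n:n\in\mathbb{N}_0\}.$$
   Context: $\mathbb{D}$ is the open unit disc in $\mathbb{C}$, $\mathrm{Hol}(\mathbb{D})$ is the Fréchet space of holomorphic functions $\mathbb{D}\to\mathbb{C}$ with the topology of uniform convergence on compact subsets of $\mathbb{D}$, $\mathrm{Aut}(\mathbb{D})$ is the group of holomorphic automorphisms of $\mathbb{D}$, and $\mathbb{N}_0=\{0,1,2,\dots\}$. The spectrum is $\sigma(C_\varphi)=\{\lambda\in\mathbb{C}:\lambda\,\mathrm{Id}-C_\varphi\text{ is not bijective on }\mathrm{Hol}(\mathbb{D})\}$. *)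

theory Defs
  imports "HOL-Complex_Analysis.Complex_Analysis" "HOL-Library.FuncSet"
begin

abbreviation unit_disc :: "complex set" (\<open>\<D>\<close>) where
  "\<D> \<equiv> ball 0 1"

text \<open>Functions on the disc are represented by total functions that are \<^const>\<open>extensional\<close>, i.e.
  equal to \<^const>\<open>undefined\<close> off the disc. Equality in this set is thus equality on the disc,
  so that injectivity of operators has its intended meaning.\<close>

definition Hol_disc :: "(complex \<Rightarrow> complex) set" where
  "Hol_disc = {f. f holomorphic_on \<D>} \<inter> extensional \<D>"

text \<open>Only the values on the disc matter for membership; elements need not be extensional.\<close>

definition Aut_disc :: "(complex \<Rightarrow> complex) set" where
  "Aut_disc = {\<phi>. \<phi> holomorphic_on \<D> \<and> bij_betw \<phi> \<D> \<D> \<and> inv_into \<D> \<phi> holomorphic_on \<D>}"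

definition composition_op :: "(complex \<Rightarrow> complex) \<Rightarrow> (complex \<Rightarrow> complex) \<Rightarrow> (complex \<Rightarrow> complex)" where
  "composition_op \<phi> f = restrict (f \<circ> \<phi>) \<D>"

definition spectrum_Hol :: "((complex \<Rightarrow> complex) \<Rightarrow> (complex \<Rightarrow> complex)) \<Rightarrow> complex set" where
  "spectrum_Hol T =
    {\<mu>. \<not> bij_betw (\<lambda>f. restrict (\<lambda>z. \<mu> * f z - T f z) \<D>) Hol_disc Hol_disc}"

end

theory Submission
  imports Defs
begin

text \<open>Near \<open>\<alpha>\<close> write \<open>f = c (z - \<alpha>)^k + \<dots>\<close> with \<open>c \<noteq> 0\<close>; then
  \<open>\<mu> f - f \<circ> \<phi> = (\<mu> - \<lambda>^k) c (z - \<alpha>)^k + \<dots>\<close> where \<open>\<lambda> = \<phi>'(\<alpha>)\<close>. Hence the eigenvalues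
  are among the \<open>\<lambda>^k\<close>, and \<open>(z - \<alpha>)^n\<close> is not in the range of \<open>\<lambda>^n - C\<^sub>\<phi>\<close>. For other \<open>\<mu> \<noteq> 0\<close>, the
  equation \<open>\<mu> f - f \<circ> \<phi> = g\<close> is solved up to order \<open>N\<close> at \<open>\<alpha>\<close> by a polynomial. If \<open>g\<close> vanishes
  to a high order \<open>N\<close>, then \<open>f = (\<Sum>k. g \<circ> \<phi>\<^sub>k / \<mu>^(k+1))\<close>, with \<open>\<phi>\<^sub>k\<close> the \<open>k\<close>-th iterate, converges
  locally uniformly, because all orbits of \<open>\<phi>\<close> tend to \<open>\<alpha>\<close> at a geometric rate. Finally, \<open>C\<^sub>\<phi>\<close> is
  bijective only if \<open>\<phi>\<close> is an automorphism.\<close>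

section \<open>The spectrum in terms of the equation \<mu> f - f \<circ> \<phi> = g on the
  disc\<close>

lemma restrict_mem_Hol_disc_iff: "restrict g \<D> \<in> Hol_disc \<longleftrightarrow> g holomorphic_on \<D>"
proof -
  have "restrict g \<D> holomorphic_on \<D> \<longleftrightarrow> g holomorphic_on \<D>"
    by (rule holomorphic_cong) simp_all
  then show ?thesis by (simp add: Hol_disc_def)
qed

text \<open>Removes \<open>restrict\<close> and extensionality from all later arguments: solvability
  and triviality of the kernel are stated for arbitrary total functions, compared on the disc only.
  Linearity reduces injectivity to the kernel.\<close>

lemma not_in_spectrum_Hol_iff:
  assumes "\<phi> holomorphic_on \<D>" and "\<phi> \<in> \<D> \<rightarrow> \<D>"
  shows "\<mu> \<notin> spectrum_Hol (composition_op \<phi>) \<longleftrightarrow>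
    (\<forall>g. g holomorphic_on \<D> \<longrightarrow> (\<exists>f. f holomorphic_on \<D> \<and> (\<forall>z\<in>\<D>. \<mu> * f z - f (\<phi> z) = g z))) \<and>
    (\<forall>f. f holomorphic_on \<D> \<longrightarrow> (\<forall>z\<in>\<D>. \<mu> * f z - f (\<phi> z) = 0) \<longrightarrow> (\<forall>z\<in>\<D>. f z = 0))"
    (is "_ \<longleftrightarrow> ?surj \<and> ?inj")
proof -
  define R where "R f = restrict (\<lambda>z. \<mu> * f z - composition_op \<phi> f z) \<D>" for f
  have R_apply: "R f z = \<mu> * f z - f (\<phi> z)" if "z \<in> \<D>" for f z
    using that by (simp add: R_def composition_op_def)
  have R_eqI: "R f = g" if "g \<in> Hol_disc" "\<And>z. z \<in> \<D> \<Longrightarrow> \<mu> * f z - f (\<phi> z) = g z" for f g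
  proof (rule extensionalityI[where A = \<D>])
    show "R f \<in> extensional \<D>" by (simp add: R_def)
    show "g \<in> extensional \<D>" using that(1) by (simp add: Hol_disc_def)
  qed (use that R_apply in auto)
  \<comment> \<open>Restricting f loses nothing, since \<phi> maps the disc into itself and so f is
    evaluated there only.\<close>
  have R_restrict: "R (restrict f \<D>) = restrict (\<lambda>z. \<mu> * f z - f (\<phi> z)) \<D>" for f
    using assms(2) by (auto simp: R_def composition_op_def restrict_def Pi_iff fun_eq_iff)
  have hol_R: "(\<lambda>z. \<mu> * f z - f (\<phi> z)) holomorphic_on \<D>" if "f holomorphic_on \<D>" for f
    using holomorphic_on_compose_gen[OF assms(1) that] assms(2) that
    by (auto intro!: holomorphic_intros simp: o_def image_subset_iff_funcset)
  have R_mem: "R f \<in> Hol_disc" if "f \<in> Hol_disc" for f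
  proof -
    from that have "f holomorphic_on \<D>" and "restrict f \<D> = f"
      by (auto simp: Hol_disc_def extensional_restrict)
    with hol_R R_restrict[of f] show ?thesis by (simp add: restrict_mem_Hol_disc_iff)
  qed
  have "\<mu> \<notin> spectrum_Hol (composition_op \<phi>) \<longleftrightarrow> bij_betw R Hol_disc Hol_disc"
    by (simp add: spectrum_Hol_def R_def[abs_def])
  also have "\<dots> \<longleftrightarrow> ?surj \<and> ?inj"
  proof (intro iffI conjI)
    assume bij: "bij_betw R Hol_disc Hol_disc"
    show ?surj
    proof (intro allI impI)
      fix g assume "g holomorphic_on \<D>"
      then have "restrict g \<D> \<in> R ` Hol_disc"
        using bij by (simp add: bij_betw_def restrict_mem_Hol_disc_iff)
      then obtain f where f: "f \<in> Hol_disc" "restrict g \<D> = R f" by blast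
      have "\<mu> * f z - f (\<phi> z) = g z" if "z \<in> \<D>" for z
        using R_apply[OF that, of f] that by (simp flip: f(2))
      then show "\<exists>f. f holomorphic_on \<D> \<and> (\<forall>z\<in>\<D>. \<mu> * f z - f (\<phi> z) = g z)"
        using f(1) by (auto simp: Hol_disc_def)
    qed
    show ?inj
    proof (intro allI impI)
      fix f assume f: "f holomorphic_on \<D>" "\<forall>z\<in>\<D>. \<mu> * f z - f (\<phi> z) = 0"
      have "R (restrict f \<D>) = R (restrict (\<lambda>_. 0) \<D>)"
        unfolding R_restrict using f(2) by (intro restrict_ext) simp
      moreover have "restrict f \<D> \<in> Hol_disc" "restrict (\<lambda>_. 0) \<D> \<in> Hol_disc"
        using f(1) by (simp_all add: restrict_mem_Hol_disc_iff)
      ultimately have "restrict f \<D> = restrict (\<lambda>_. 0) \<D>"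
        using bij by (auto simp: bij_betw_def dest: inj_onD)
      then show "\<forall>z\<in>\<D>. f z = 0" by (metis restrict_apply')
    qed
  next
    assume *: "?surj \<and> ?inj"
    show "bij_betw R Hol_disc Hol_disc"
    proof (rule bij_betw_imageI)
      show "inj_on R Hol_disc"
      proof (rule inj_onI)
        fix f g assume fg: "f \<in> Hol_disc" "g \<in> Hol_disc" "R f = R g"
        have "\<mu> * (f z - g z) - (f (\<phi> z) - g (\<phi> z)) = 0" if "z \<in> \<D>" for z
          using R_apply[OF that, of f] R_apply[OF that, of g] fg(3) by (simp add: algebra_simps)
        moreover have "(\<lambda>z. f z - g z) holomorphic_on \<D>"
          using fg by (auto simp: Hol_disc_def intro!: holomorphic_intros)
        ultimately have "\<forall>z\<in>\<D>. f z - g z = 0" using * by blast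
        then show "f = g"
          using fg by (intro extensionalityI[of f \<D> g]) (auto simp: Hol_disc_def)
      qed
      show "R ` Hol_disc = Hol_disc"
      proof (rule antisym)
        show "R ` Hol_disc \<subseteq> Hol_disc" using R_mem by blast
        show "Hol_disc \<subseteq> R ` Hol_disc"
        proof
          fix g assume g: "g \<in> Hol_disc"
          then have "g holomorphic_on \<D>" by (simp add: Hol_disc_def)
          then obtain f where f: "f holomorphic_on \<D>" "\<forall>z\<in>\<D>. \<mu> * f z - f (\<phi> z) = g z"
            using * by blast
          have "R (restrict f \<D>) = g"
            using f(2) assms(2) by (intro R_eqI g) (auto simp: Pi_iff)
          then show "g \<in> R ` Hol_disc"
            using f(1) restrict_mem_Hol_disc_iff by blast
        qed
      qed
    qed
  qed
  finally show ?thesis .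
qed

section \<open>The spectral value 0 and automorphisms\<close>

text \<open>Solving f \<circ> \<phi> = id yields a holomorphic left inverse of \<phi>. If \<phi>
  missed w, then 1/(\<phi> - w) = f \<circ> \<phi> for some holomorphic f, so f(z)(z - w) - 1 would
  be killed by composition with \<phi>. It would thus vanish on the disc, yet it is -1 at w.\<close>

lemma Aut_disc_if_0_notin_spectrum:
  assumes hol: "\<phi> holomorphic_on \<D>" and maps: "\<phi> \<in> \<D> \<rightarrow> \<D>"
    and "0 \<notin> spectrum_Hol (composition_op \<phi>)"
  shows "\<phi> \<in> Aut_disc"
proof -
  have surj: "\<exists>f. f holomorphic_on \<D> \<and> (\<forall>z\<in>\<D>. f (\<phi> z) = g z)" if "g holomorphic_on \<D>" for g
  proof -
    \<comment> \<open>For \<mu> = 0 the operator is f \<mapsto> - f \<circ> \<phi>, hence the change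
      of sign.\<close>
    have "(\<lambda>z. - g z) holomorphic_on \<D>" using that by (intro holomorphic_intros)
    then show ?thesis
      using assms(3) unfolding not_in_spectrum_Hol_iff[OF hol maps] by fastforce
  qed
  have inj: "f z = 0" if "f holomorphic_on \<D>" "\<And>z. z \<in> \<D> \<Longrightarrow> f (\<phi> z) = 0" "z \<in> \<D>" for f z
    using assms(3) that unfolding not_in_spectrum_Hol_iff[OF hol maps] by simp
  obtain \<psi> where \<psi>: "\<psi> holomorphic_on \<D>" "\<And>z. z \<in> \<D> \<Longrightarrow> \<psi> (\<phi> z) = z"
    using surj[of "\<lambda>z. z"] by auto
  have "inj_on \<phi> \<D>" using \<psi>(2) by (metis inj_onI)
  moreover have "w \<in> \<phi> ` \<D>" if w: "w \<in> \<D>" for w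
  proof (rule ccontr)
    assume "w \<notin> \<phi> ` \<D>"
    then have "(\<lambda>z. 1 / (\<phi> z - w)) holomorphic_on \<D>"
      by (intro holomorphic_intros hol) auto
    then obtain f where f: "f holomorphic_on \<D>" "\<And>z. z \<in> \<D> \<Longrightarrow> f (\<phi> z) = 1 / (\<phi> z - w)"
      using surj by blast
    have "f w * (w - w) - 1 = 0"
    proof (rule inj[where f = "\<lambda>z. f z * (z - w) - 1", OF _ _ w])
      show "(\<lambda>z. f z * (z - w) - 1) holomorphic_on \<D>"
        by (intro holomorphic_intros f)
      show "f (\<phi> z) * (\<phi> z - w) - 1 = 0" if "z \<in> \<D>" for z
        using f(2)[OF that] \<open>w \<notin> \<phi> ` \<D>\<close> that by auto
    qed
    then show False by simp
  qed
  ultimately have bij: "bij_betw \<phi> \<D> \<D>"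
    using maps by (auto simp: bij_betw_def)
  have "inv_into \<D> \<phi> w = \<psi> w" if "w \<in> \<D>" for w
    using \<psi>(2)[OF inv_into_into, of w \<phi>] f_inv_into_f[of w \<phi> \<D>] bij that
    by (simp add: bij_betw_def del: mem_ball mem_ball_0)
  then have "inv_into \<D> \<phi> holomorphic_on \<D>"
    using holomorphic_cong[OF refl, of \<D> "inv_into \<D> \<phi>" \<psi>] \<psi>(1) by blast
  with hol bij show ?thesis by (simp add: Aut_disc_def)
qed

section \<open>Convergence of orbits to the fixed point\<close>

text \<open>By the Schwarz lemma F(z) = z h(z), and |h| < 1 on the disc because F is no rotation.
  Compactness gives a contraction factor c < 1 on the closed disc of radius |z|, which the orbit of
  z never leaves.\<close>

lemma funpow_tendsto_0:
  fixes F :: "complex \<Rightarrow> complex"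
  assumes hol: "F holomorphic_on \<D>" and maps: "F \<in> \<D> \<rightarrow> \<D>" and "F 0 = 0"
    and deriv: "cmod (deriv F 0) < 1" and z: "z \<in> \<D>"
  shows "(\<lambda>k. (F ^^ k) z) \<longlonglongrightarrow> 0"
proof -
  obtain h where h: "h holomorphic_on \<D>" "\<And>z. cmod z < 1 \<Longrightarrow> F z = z * h z" "deriv F 0 = h 0"
    using Schwarz3[OF hol \<open>F 0 = 0\<close>] by auto
  have F: "cmod (F w) < 1" if "cmod w < 1" for w
    using maps that by auto
  have h_less: "cmod (h w) < 1" if w: "cmod w < 1" for w
  proof (cases "w = 0")
    case False
    have "cmod (F w) \<le> cmod w"
      using Schwarz_Lemma(1)[OF hol \<open>F 0 = 0\<close> F w] .
    \<comment> \<open>Equality at one nonzero point makes F a rotation, whose derivative at 0 has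
      modulus 1.\<close>
    moreover have "cmod (F w) \<noteq> cmod w"
    proof
      assume "cmod (F w) = cmod w"
      then have "\<exists>z. cmod z < 1 \<and> z \<noteq> 0 \<and> cmod (F z) = cmod z"
        using False w by blast
      then obtain c where c: "\<And>z. cmod z < 1 \<Longrightarrow> F z = c * z" "cmod c = 1"
        using Schwarz_Lemma(3)[OF hol \<open>F 0 = 0\<close> _ w] F by blast
      have "(F has_field_derivative c) (at 0)"
      proof (rule has_field_derivative_transform_within_open[where S = \<D>])
        show "((\<lambda>z. c * z) has_field_derivative c) (at 0)"
          by (auto intro!: derivative_eq_intros)
      qed (use c in auto)
      with deriv c(2) show False by (simp add: DERIV_imp_deriv)
    qed
    ultimately have "cmod w * cmod (h w) < cmod w * 1"
      using h(2)[OF w] by (simp add: norm_mult)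
    then show ?thesis using False by (simp add: mult_less_cancel_left_pos)
  qed (use deriv h(3) in simp)
  have z1: "cmod z < 1" using z by simp
  have "continuous_on (cball 0 (cmod z)) (\<lambda>w. cmod (h w))"
    using h(1) z1 by (intro continuous_intros holomorphic_on_imp_continuous_on)
      auto
  moreover have "cball (0::complex) (cmod z) \<noteq> {}" by simp
  ultimately obtain m where m: "m \<in> cball 0 (cmod z)"
    "\<And>w. w \<in> cball 0 (cmod z) \<Longrightarrow> cmod (h w) \<le> cmod (h m)"
    using continuous_attains_sup[OF compact_cball] by metis
  define c where "c = cmod (h m)"
  have c: "0 \<le> c" "c < 1" using h_less m(1) z1 by (auto simp: c_def)
  have bound: "cmod ((F ^^ k) z) \<le> c ^ k * cmod z" for k
  proof (induction k)
    case (Suc k)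
    have "c ^ k * cmod z \<le> cmod z"
      using c by (simp add: mult_left_le_one_le power_le_one)
    then have le: "cmod ((F ^^ k) z) \<le> cmod z" using Suc by linarith
    then have "cmod ((F ^^ Suc k) z) = cmod ((F ^^ k) z) * cmod (h ((F ^^ k) z))"
      using h(2)[of "(F ^^ k) z"] z1 by (simp add: norm_mult)
    also have "\<dots> \<le> (c ^ k * cmod z) * c"
      using le m(2) c Suc by (intro mult_mono) (auto simp: c_def)
    finally show ?case by (simp add: mult_ac)
  qed simp
  show ?thesis
  proof (rule Lim_null_comparison)
    show "\<forall>\<^sub>F k in sequentially. cmod ((F ^^ k) z) \<le> c ^ k * cmod z"
      using bound by simp
    show "(\<lambda>k. c ^ k * cmod z) \<longlonglongrightarrow> 0"
      using c by (intro tendsto_mult_left_zero LIMSEQ_realpow_zero)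
  qed
qed

locale disc_fixpoint =
  fixes \<phi> :: "complex \<Rightarrow> complex" and \<alpha> :: complex
  assumes hol: "\<phi> holomorphic_on \<D>"
    and maps: "\<phi> \<in> \<D> \<rightarrow> \<D>"
    and \<alpha>_in: "\<alpha> \<in> \<D>"
    and fixpoint: "\<phi> \<alpha> = \<alpha>"
    and deriv_less: "cmod (deriv \<phi> \<alpha>) < 1"
begin

lemma \<phi>_in: "z \<in> \<D> \<Longrightarrow> \<phi> z \<in> \<D>"
  using maps by blast

lemma funpow_in: "z \<in> \<D> \<Longrightarrow> (\<phi> ^^ k) z \<in> \<D>"
  by (induction k) (simp_all add: \<phi>_in del: mem_ball mem_ball_0)

lemma funpow_holomorphic: "(\<phi> ^^ k) holomorphic_on \<D>"
proof (induction k)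
  case (Suc k)
  then show ?case
    using holomorphic_on_compose_gen[OF Suc hol] funpow_in by (simp add: image_subset_iff o_def)
qed (simp add: id_def)

text \<open>The difference quotient at \<alpha> has a removable singularity. Raising the identity to
  a power shows how composition with \<phi> acts on (z - \<alpha>)^k: it multiplies it by
  \<psi>^k.\<close>

lemma factor:
  obtains \<psi> where "\<psi> holomorphic_on \<D>" "\<psi> \<alpha> = deriv \<phi> \<alpha>" "\<And>z. \<phi> z - \<alpha> = (z - \<alpha>) * \<psi> z"
proof
  show "(\<lambda>z. if z = \<alpha> then deriv \<phi> \<alpha> else (\<phi> z - \<phi> \<alpha>) / (z - \<alpha>)) holomorphic_on \<D>"
    by (intro pole_lemma_open hol open_ball)
qed (simp_all add: fixpoint)

text \<open>A Moebius map carries \<alpha> to 0, which reduces the claim to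
  \<open>funpow_tendsto_0\<close>; conjugation preserves the derivative at the fixed point.\<close>

lemma funpow_tendsto:
  assumes z: "z \<in> \<D>"
  shows "(\<lambda>k. (\<phi> ^^ k) z) \<longlonglongrightarrow> \<alpha>"
proof -
  define M where "M = Moebius_function 0 \<alpha>"
  define M' where "M' = Moebius_function 0 (- \<alpha>)"
  have \<alpha>1: "cmod \<alpha> < 1" using \<alpha>_in by simp
  have hol_M: "M holomorphic_on \<D>" "M' holomorphic_on \<D>"
    using \<alpha>1 by (simp_all add: M_def M'_def Moebius_function_holomorphic)
  have M_in: "M w \<in> \<D>" "M' w \<in> \<D>" if "w \<in> \<D>" for w
    using \<alpha>1 that by (simp_all add: M_def M'_def Moebius_function_norm_lt_1)
  have inv: "M (M' w) = w" "M' (M w) = w" if "w \<in> \<D>" for w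
    using \<alpha>1 that by (simp_all add: M_def M'_def Moebius_function_compose)
  have M'0: "M' 0 = \<alpha>" "M \<alpha> = 0"
    by (simp_all add: M_def M'_def Moebius_function_simple)
  define F where "F = M \<circ> \<phi> \<circ> M'"
  have F_in: "F \<in> \<D> \<rightarrow> \<D>" using M_in maps by (auto simp: F_def Pi_iff simp del: mem_ball mem_ball_0)
  have hol_F: "F holomorphic_on \<D>"
    unfolding F_def using hol_M hol M_in \<phi>_in
    by (intro holomorphic_on_compose_gen[where t = \<D>]) (auto simp del: mem_ball mem_ball_0)
  have F0: "F 0 = 0" by (simp add: F_def M'0 fixpoint)
  have D_at: "(f has_field_derivative deriv f w) (at w)" if "f holomorphic_on \<D>" "w \<in> \<D>" for f w
    using that holomorphic_derivI open_ball by blast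
  \<comment> \<open>The derivative of \<open>M'\<close> at 0 is 1 - |\<alpha>|^2, which is nonzero
    and can be cancelled below.\<close>
  have "((\<lambda>w. (w + \<alpha>) / (1 + cnj \<alpha> * w)) has_field_derivative 1 - \<alpha> * cnj \<alpha>) (at 0)"
    by (auto intro!: derivative_eq_intros)
  then have "deriv M' 0 = 1 - \<alpha> * cnj \<alpha>"
    unfolding M'_def Moebius_function_simple by (simp add: DERIV_imp_deriv)
  moreover have "cmod (\<alpha> * cnj \<alpha>) < 1"
    using norm_mult_less[of \<alpha> 1 "cnj \<alpha>" 1] \<alpha>1 by simp
  ultimately have M'_nz: "deriv M' 0 \<noteq> 0" by auto
  have d1: "((\<lambda>w. \<phi> (M' w)) has_field_derivative deriv \<phi> \<alpha> * deriv M' 0) (at 0)"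
    using DERIV_chain2[of \<phi> _ M' 0] D_at[OF hol \<alpha>_in] D_at[OF hol_M(2), of 0] M'0 by simp
  have M'_F: "M' (F w) = \<phi> (M' w)" if "w \<in> \<D>" for w
    using that by (simp add: F_def inv \<phi>_in M_in del: mem_ball mem_ball_0)
  \<comment> \<open>Second computation of the derivative in \<open>d1\<close>, now through \<phi>
    \<circ> M' = M' \<circ> F.\<close>
  have "((\<lambda>w. \<phi> (M' w)) has_field_derivative deriv M' 0 * deriv F 0) (at 0)"
  proof (rule has_field_derivative_transform_within_open[where S = \<D>])
    show "((\<lambda>w. M' (F w)) has_field_derivative deriv M' 0 * deriv F 0) (at 0)"
      using DERIV_chain2[of M' _ F 0] D_at[OF hol_M(2), of 0] D_at[OF hol_F, of 0] F0 by simp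
  qed (use M'_F in auto)
  with d1 have "deriv \<phi> \<alpha> * deriv M' 0 = deriv M' 0 * deriv F 0"
    by (rule DERIV_unique)
  with M'_nz have "deriv F 0 = deriv \<phi> \<alpha>" by simp
  then have F_lim: "(\<lambda>k. (F ^^ k) (M z)) \<longlonglongrightarrow> 0"
    using funpow_tendsto_0[OF hol_F F_in F0] deriv_less M_in(1)[OF z] by simp
  have conj: "(\<phi> ^^ k) z = M' ((F ^^ k) (M z))" for k
  proof (induction k)
    case (Suc k)
    have "(F ^^ k) (M z) \<in> \<D>"
      using F_in M_in(1)[OF z] by (induction k) (auto simp: Pi_iff simp del: mem_ball mem_ball_0)
    with Suc show ?case by (simp add: M'_F del: mem_ball mem_ball_0)
  qed (use inv z in simp)
  have "isCont M' 0"
    using hol_M(2) by (intro DERIV_isCont[OF D_at]) auto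
  then have "(\<lambda>k. M' ((F ^^ k) (M z))) \<longlonglongrightarrow> M' 0"
    using F_lim by (rule isCont_tendsto_compose)
  then show ?thesis by (simp add: conj M'0)
qed

section \<open>Leading terms at the fixed point: kernel and range\<close>

text \<open>Here k is the order of vanishing of f at \<alpha>, and c = h(\<alpha>) for the cofactor
  h in f(z) = (z - \<alpha>)^k h(z). Near \<alpha> the quotient is \<mu> h - \<psi>^k (h \<circ>
  \<phi>), which is continuous at \<alpha>.\<close>

lemma resolvent_leading_term:
  assumes f: "f holomorphic_on \<D>" and nz: "z0 \<in> \<D>" "f z0 \<noteq> 0"
  obtains k c where "c \<noteq> 0"
    "((\<lambda>z. (\<mu> * f z - f (\<phi> z)) / (z - \<alpha>) ^ k) \<longlongrightarrow> (\<mu> - deriv \<phi> \<alpha> ^ k) * c) (at \<alpha>)"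
proof -
  \<comment> \<open>A zero at \<alpha> has finite order, since f z0 \<noteq> 0 makes f nonconstant.
    If f \<alpha> \<noteq> 0, take k = 0 and h = f.\<close>
  obtain k r h where h: "0 < r" "ball \<alpha> r \<subseteq> \<D>" "h holomorphic_on ball \<alpha> r"
      "\<And>w. w \<in> ball \<alpha> r \<Longrightarrow> f w = (w - \<alpha>) ^ k * h w" "h \<alpha> \<noteq> 0"
  proof (cases "f \<alpha> = 0")
    case True
    then have "\<not> f constant_on \<D>"
      using nz \<alpha>_in unfolding constant_on_def by metis
    with True show ?thesis
      using holomorphic_factor_zero_nonconstant[OF f open_ball connected_ball \<alpha>_in] that
      by (metis centre_in_ball)
  next
    case False
    obtain r where "0 < r" "ball \<alpha> r \<subseteq> \<D>"
      using \<alpha>_in open_ball open_contains_ball by blast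
    with that[of r f 0] False holomorphic_on_subset[OF f] show ?thesis
      by simp
  qed
  obtain \<psi> where \<psi>: "\<psi> holomorphic_on \<D>" "\<psi> \<alpha> = deriv \<phi> \<alpha>"
      "\<And>z. \<phi> z - \<alpha> = (z - \<alpha>) * \<psi> z"
    using factor by blast
  have cont: "isCont g \<alpha>" if "g holomorphic_on S" "open S" "\<alpha> \<in> S" for g S
    using that holomorphic_on_imp_continuous_on continuous_on_eq_continuous_at by blast
  have cont\<phi>: "isCont \<phi> \<alpha>" and cont\<psi>: "isCont \<psi> \<alpha>" and conth: "isCont h \<alpha>"
    using cont[OF hol open_ball \<alpha>_in] cont[OF \<psi>(1) open_ball \<alpha>_in] cont[OF h(3) open_ball] h(1)
    by simp_all
  have "isCont (\<lambda>z. h (\<phi> z)) \<alpha>"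
    by (rule isCont_o2[OF cont\<phi>]) (simp add: fixpoint conth)
  then have "isCont (\<lambda>z. \<mu> * h z - \<psi> z ^ k * h (\<phi> z)) \<alpha>"
    by (intro continuous_intros cont\<psi> conth)
  then have "((\<lambda>z. \<mu> * h z - \<psi> z ^ k * h (\<phi> z)) \<longlongrightarrow> (\<mu> - deriv \<phi> \<alpha> ^ k) * h \<alpha>) (at \<alpha>)"
    by (simp add: isCont_def fixpoint \<psi>(2) algebra_simps)
  moreover have "\<forall>\<^sub>F z in at \<alpha>. (\<mu> * f z - f (\<phi> z)) / (z - \<alpha>) ^ k = \<mu> * h z - \<psi> z ^ k * h (\<phi> z)"
  proof -
    \<comment> \<open>The local factorization of f must also apply at \<phi> z.\<close>
    have "\<forall>\<^sub>F z in at \<alpha>. \<phi> z \<in> ball \<alpha> r"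
      using cont\<phi> h(1) fixpoint unfolding isCont_def
      by (metis centre_in_ball open_ball topological_tendstoD)
    moreover have "\<forall>\<^sub>F z in at \<alpha>. z \<in> ball \<alpha> r"
      using h(1) by (intro eventually_at_in_open') auto
    moreover have "\<forall>\<^sub>F z in at \<alpha>. z \<noteq> \<alpha>" by (rule eventually_neq_at_within)
    ultimately show ?thesis
    proof eventually_elim
      case (elim z)
      have "f (\<phi> z) = (z - \<alpha>) ^ k * (\<psi> z ^ k * h (\<phi> z))"
        using h(4)[OF elim(1)] by (simp add: \<psi>(3) power_mult_distrib)
      then have "\<mu> * f z - f (\<phi> z) = (z - \<alpha>) ^ k * (\<mu> * h z - \<psi> z ^ k * h (\<phi> z))"
        using h(4)[OF elim(2)] by (simp add: algebra_simps)
      then show ?case using elim(3) by simp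
    qed
  qed
  ultimately have "((\<lambda>z. (\<mu> * f z - f (\<phi> z)) / (z - \<alpha>) ^ k) \<longlongrightarrow> (\<mu> - deriv \<phi> \<alpha> ^ k) * h \<alpha>) (at \<alpha>)"
    by (simp add: tendsto_cong)
  with h(5) that show ?thesis by blast
qed

lemma eigenvalue_power:
  assumes "f holomorphic_on \<D>" "\<And>z. z \<in> \<D> \<Longrightarrow> \<mu> * f z - f (\<phi> z) = 0" and "z0 \<in> \<D>" "f z0 \<noteq> 0"
  obtains k where "\<mu> = deriv \<phi> \<alpha> ^ k"
proof -
  obtain k c where c: "c \<noteq> 0"
    and lim: "((\<lambda>z. (\<mu> * f z - f (\<phi> z)) / (z - \<alpha>) ^ k) \<longlongrightarrow> (\<mu> - deriv \<phi> \<alpha> ^ k) * c) (at \<alpha>)"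
    by (rule resolvent_leading_term[OF assms(1,3,4)])
  have "\<forall>\<^sub>F z in at \<alpha>. z \<in> \<D>"
    using \<alpha>_in by (intro eventually_at_in_open') auto
  then have "\<forall>\<^sub>F z in at \<alpha>. (\<mu> * f z - f (\<phi> z)) / (z - \<alpha>) ^ k = 0"
    by eventually_elim (simp add: assms(2))
  then have "((\<lambda>z. (\<mu> * f z - f (\<phi> z)) / (z - \<alpha>) ^ k) \<longlongrightarrow> 0) (at \<alpha>)"
    by (rule tendsto_eventually)
  then have "(\<mu> - deriv \<phi> \<alpha> ^ k) * c = 0"
    using lim tendsto_unique trivial_limit_at by blast
  with c that show ?thesis by simp
qed

text \<open>Let f vanish to order k and put \<lambda> = \<open>deriv \<phi> \<alpha>\<close>. If k <
  n, comparing limits forces \<lambda>^n = \<lambda>^k, impossible for 0 < |\<lambda>| < 1. If k =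
  n, the factor \<lambda>^n - \<lambda>^k is 0 but the limit is 1. If k > n, the left side vanishes
  to higher order than the right.\<close>

lemma monomial_not_in_range:
  assumes "deriv \<phi> \<alpha> \<noteq> 0" and f: "f holomorphic_on \<D>"
    and eq: "\<And>z. z \<in> \<D> \<Longrightarrow> deriv \<phi> \<alpha> ^ n * f z - f (\<phi> z) = (z - \<alpha>) ^ n"
  shows False
proof -
  let ?l = "deriv \<phi> \<alpha>"
  \<comment> \<open>If f were 0 on the disc, then so would be (z - \<alpha>)^n, and both 0 and 1/2
    would equal \<alpha>.\<close>
  have "\<exists>z0\<in>\<D>. f z0 \<noteq> 0"
  proof (rule ccontr)
    assume "\<not> ?thesis"
    then have "(z - \<alpha>) ^ n = 0" if "z \<in> \<D>" for z
      using eq[OF that] that \<phi>_in by simp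
    then have "z = \<alpha>" if "z \<in> \<D>" for z using that by fastforce
    from this[of 0] this[of "1/2"] show False by simp
  qed
  then obtain z0 where "z0 \<in> \<D>" "f z0 \<noteq> 0" by blast
  then obtain k c where c: "c \<noteq> 0"
    and lim: "((\<lambda>z. (?l ^ n * f z - f (\<phi> z)) / (z - \<alpha>) ^ k) \<longlongrightarrow> (?l ^ n - ?l ^ k) * c) (at \<alpha>)"
    by (rule resolvent_leading_term[OF f])
  have ev: "\<forall>\<^sub>F z in at \<alpha>. z \<in> \<D>"
    using \<alpha>_in by (intro eventually_at_in_open') auto
  have ne: "\<forall>\<^sub>F z in at \<alpha>. z \<noteq> \<alpha>" by (rule eventually_neq_at_within)
  show False
  proof (cases "k \<le> n")
    case True
    have "\<forall>\<^sub>F z in at \<alpha>. (?l ^ n * f z - f (\<phi> z)) / (z - \<alpha>) ^ k = (z - \<alpha>) ^ (n - k)"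
      using ev ne by eventually_elim (use True eq in \<open>simp add: power_diff\<close>)
    with lim have "((\<lambda>z. (z - \<alpha>) ^ (n - k)) \<longlongrightarrow> (?l ^ n - ?l ^ k) * c) (at \<alpha>)"
      by (simp add: tendsto_cong)
    moreover have "((\<lambda>z. (z - \<alpha>) ^ (n - k)) \<longlongrightarrow> (\<alpha> - \<alpha>) ^ (n - k)) (at \<alpha>)"
      by (intro tendsto_intros)
    \<comment> \<open>The right side is 1 for k = n and 0 for k < n.\<close>
    ultimately have *: "(?l ^ n - ?l ^ k) * c = 0 ^ (n - k)"
      using tendsto_unique trivial_limit_at by fastforce
    show False
    proof (cases "k = n")
      case False
      with * c True have "cmod ?l ^ n = cmod ?l ^ k"
        by (simp add: power_0_left flip: norm_power)
      moreover have "cmod ?l ^ n < cmod ?l ^ k"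
        using False True assms(1) deriv_less by (intro power_strict_decreasing) auto
      ultimately show False by simp
    qed (use * in simp)
  next
    case False
    have "((\<lambda>z. (z - \<alpha>) ^ (k - n) * ((?l ^ n * f z - f (\<phi> z)) / (z - \<alpha>) ^ k))
        \<longlongrightarrow> (\<alpha> - \<alpha>) ^ (k - n) * ((?l ^ n - ?l ^ k) * c)) (at \<alpha>)"
      by (intro tendsto_intros lim)
    moreover have "\<forall>\<^sub>F z in at \<alpha>. (z - \<alpha>) ^ (k - n) * ((?l ^ n * f z - f (\<phi> z)) / (z - \<alpha>) ^ k) = 1"
      using ev ne
    proof eventually_elim
      case (elim z)
      have "(z - \<alpha>) ^ k = (z - \<alpha>) ^ (k - n) * (z - \<alpha>) ^ n"
        using False by (simp flip: power_add)
      with elim eq show ?case by simp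
    qed
    ultimately have "((\<lambda>z. 1) \<longlongrightarrow> (\<alpha> - \<alpha>) ^ (k - n) * ((?l ^ n - ?l ^ k) * c)) (at \<alpha>)"
      by (rule Lim_transform_eventually)
    then have "(\<alpha> - \<alpha>) ^ (k - n) * ((?l ^ n - ?l ^ k) * c) = 1"
      by (metis tendsto_const tendsto_unique trivial_limit_at)
    then show False using False by (simp add: power_0_left)
  qed
qed

section \<open>Solving the equation for the other values of \<mu>\<close>

text \<open>Induction on N: each step adds a multiple of (z - \<alpha>)^N to p, so that the
  remainder gains one more zero at \<alpha>. Dividing by \<mu> - \<lambda>^N, with \<lambda> =
  \<open>deriv \<phi> \<alpha>\<close>, is where the hypothesis on \<mu> enters.\<close>

lemma solve_modulo_order:
  assumes g: "g holomorphic_on \<D>" and \<mu>: "\<And>n. \<mu> \<noteq> deriv \<phi> \<alpha> ^ n"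
  obtains p h where "p holomorphic_on \<D>" "h holomorphic_on \<D>"
    "\<And>z. z \<in> \<D> \<Longrightarrow> g z = \<mu> * p z - p (\<phi> z) + (z - \<alpha>) ^ N * h z"
proof -
  have "\<exists>p h. p holomorphic_on \<D> \<and> h holomorphic_on \<D> \<and>
    (\<forall>z\<in>\<D>. g z = \<mu> * p z - p (\<phi> z) + (z - \<alpha>) ^ N * h z)"
  proof (induction N)
    case 0
    show ?case
      using g by (intro exI[of _ "\<lambda>_. 0"] exI[of _ g]) auto
  next
    case (Suc N)
    then obtain p h where p: "p holomorphic_on \<D>" and h: "h holomorphic_on \<D>"
      and eq: "\<And>z. z \<in> \<D> \<Longrightarrow> g z = \<mu> * p z - p (\<phi> z) + (z - \<alpha>) ^ N * h z" by blast
    obtain \<psi> where \<psi>: "\<psi> holomorphic_on \<D>" "\<psi> \<alpha> = deriv \<phi> \<alpha>"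
        "\<And>z. \<phi> z - \<alpha> = (z - \<alpha>) * \<psi> z"
      using factor by blast
    \<comment> \<open>The term c (z - \<alpha>)^N contributes c (\<mu> - \<psi>^N)(z - \<alpha>)^N
      to the equation; this c makes the remaining cofactor \<open>u\<close> vanish at
      \<alpha>.\<close>
    define c where "c = h \<alpha> / (\<mu> - deriv \<phi> \<alpha> ^ N)"
    define u where "u z = h z - c * (\<mu> - \<psi> z ^ N)" for z
    have hol_u: "u holomorphic_on \<D>"
      unfolding u_def by (intro holomorphic_intros h \<psi>(1))
    have u0: "u \<alpha> = 0"
      using \<mu>[of N] by (simp add: u_def c_def \<psi>(2))
    define v where "v z = (if z = \<alpha> then deriv u \<alpha> else (u z - u \<alpha>) / (z - \<alpha>))" for z
    have hol_v: "v holomorphic_on \<D>"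
      unfolding v_def by (intro pole_lemma_open hol_u open_ball)
    have uv: "u z = (z - \<alpha>) * v z" for z
      by (simp add: v_def u0)
    define q where "q z = p z + c * (z - \<alpha>) ^ N" for z
    have "q holomorphic_on \<D>"
      unfolding q_def by (intro holomorphic_intros p)
    moreover have "g z = \<mu> * q z - q (\<phi> z) + (z - \<alpha>) ^ Suc N * v z" if "z \<in> \<D>" for z
    proof -
      have "(z - \<alpha>) ^ Suc N * v z = (z - \<alpha>) ^ N * u z"
        by (simp add: uv)
      moreover have "(\<phi> z - \<alpha>) ^ N = (z - \<alpha>) ^ N * \<psi> z ^ N"
        by (simp only: \<psi>(3) power_mult_distrib)
      ultimately show ?thesis
        by (simp only: eq[OF that] q_def u_def) (simp add: algebra_simps)
    qed
    ultimately show ?case using hol_v by blast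
  qed
  with that show ?thesis by blast
qed

text \<open>The solution is a Neumann series. Orbits approach \<alpha> at rate \<rho> and the right
  side has a zero of order N there, so the terms decay like (\<rho>^N/|\<mu>|)^k, a convergent
  geometric series by the choice of N.\<close>

lemma solve_high_order:
  assumes h: "h holomorphic_on \<D>" and \<rho>: "cmod (deriv \<phi> \<alpha>) < \<rho>" "\<rho> < 1"
    and N: "\<rho> ^ N < cmod \<mu>"
  obtains f where "f holomorphic_on \<D>" "\<And>z. z \<in> \<D> \<Longrightarrow> \<mu> * f z - f (\<phi> z) = (z - \<alpha>) ^ N * h z"
proof -
  have \<rho>0: "0 < \<rho>" using \<rho>(1) norm_ge_zero le_less_trans by blast
  have \<mu>0: "\<mu> \<noteq> 0" using N \<rho>0 by (metis norm_zero not_less_iff_gr_or_eq zero_less_power)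
  define g where "g z = (z - \<alpha>) ^ N * h z" for z
  have hol_g: "g holomorphic_on \<D>"
    unfolding g_def by (intro holomorphic_intros h)
  obtain \<psi> where \<psi>: "\<psi> holomorphic_on \<D>" "\<psi> \<alpha> = deriv \<phi> \<alpha>"
      "\<And>z. \<phi> z - \<alpha> = (z - \<alpha>) * \<psi> z"
    using factor by blast
  obtain \<delta> where \<delta>: "0 < \<delta>" "cball \<alpha> \<delta> \<subseteq> \<D>" "\<And>z. z \<in> cball \<alpha> \<delta> \<Longrightarrow> cmod (\<psi> z) < \<rho>"
  proof -
    have "continuous_on \<D> (\<lambda>z. cmod (\<psi> z))"
      using \<psi>(1) by (intro continuous_intros holomorphic_on_imp_continuous_on)
    then have "open (\<D> \<inter> (\<lambda>z. cmod (\<psi> z)) -` {..<\<rho>})"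
      by (intro continuous_open_preimage) auto
    moreover have "\<alpha> \<in> \<D> \<inter> (\<lambda>z. cmod (\<psi> z)) -` {..<\<rho>}"
      using \<alpha>_in \<psi>(2) \<rho>(1) by simp
    ultimately obtain \<delta> where "0 < \<delta>" "cball \<alpha> \<delta> \<subseteq> \<D> \<inter> (\<lambda>z. cmod (\<psi> z)) -` {..<\<rho>}"
      using open_contains_cball by blast
    with that[of \<delta>] show ?thesis by blast
  qed
  \<comment> \<open>Each application of \<phi> multiplies the distance to \<alpha> by |\<psi>| <
    \<rho>, so the orbit also stays in the small ball.\<close>
  have contract: "(\<phi> ^^ k) z \<in> cball \<alpha> \<delta> \<and> cmod ((\<phi> ^^ k) z - \<alpha>) \<le> \<rho> ^ k * \<delta>"
    if "z \<in> cball \<alpha> \<delta>" for z k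
  proof (induction k)
    case 0
    then show ?case using that by (simp add: dist_norm norm_minus_commute)
  next
    case (Suc k)
    then have "cmod ((\<phi> ^^ Suc k) z - \<alpha>) = cmod ((\<phi> ^^ k) z - \<alpha>) * cmod (\<psi> ((\<phi> ^^ k) z))"
      by (simp add: \<psi>(3) norm_mult)
    also have "\<dots> \<le> (\<rho> ^ k * \<delta>) * \<rho>"
      using Suc \<delta>(1,3) \<rho>0 by (intro mult_mono) (auto simp del: mem_cball intro: less_imp_le)
    finally have *: "cmod ((\<phi> ^^ Suc k) z - \<alpha>) \<le> \<rho> ^ Suc k * \<delta>" by (simp add: mult_ac)
    also have "\<dots> \<le> 1 * \<delta>"
      using \<rho> \<rho>0 \<delta>(1) by (intro mult_right_mono power_le_one) auto
    finally show ?case using * by (simp add: dist_norm norm_minus_commute)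
  qed
  obtain B where B: "0 < B" "\<And>z. z \<in> cball \<alpha> \<delta> \<Longrightarrow> cmod (h z) \<le> B"
  proof -
    have "bounded (h ` cball \<alpha> \<delta>)"
      using h \<delta>(2) by (intro compact_imp_bounded compact_continuous_image
          holomorphic_on_imp_continuous_on compact_cball) (rule holomorphic_on_subset)
    with that show ?thesis by (auto simp: bounded_pos)
  qed
  define t where "t k z = g ((\<phi> ^^ k) z) / \<mu> ^ Suc k" for k z
  define f where "f z = (\<Sum>k. t k z)" for z
  have hol_t: "t k holomorphic_on \<D>" for k
    unfolding t_def using \<mu>0 holomorphic_on_compose_gen[OF funpow_holomorphic hol_g] funpow_in
    by (intro holomorphic_intros) (auto simp: o_def image_subset_iff simp del: mem_ball mem_ball_0)
  define a where "a k = (\<rho> ^ N / cmod \<mu>) ^ k" for k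
  have "summable a"
    unfolding a_def using N \<rho>0 \<mu>0 by (intro summable_geometric) (simp add: divide_simps)
  \<comment> \<open>Some iterate k0 sends z, and by continuity a whole neighbourhood of z, into the
    ball of contraction. The bound holds from k0 on; the delay is absorbed into the constant by the
    factor (1/\<rho>^k0)^N.\<close>
  have local_bound: "\<exists>d>0. cball z d \<subseteq> \<D> \<and> (\<exists>C. \<exists>k0. \<forall>k\<ge>k0. \<forall>w\<in>cball z d. cmod (t k w) \<le> C * a k)"
    if z: "z \<in> \<D>" for z
  proof -
    have "\<forall>\<^sub>F k in sequentially. (\<phi> ^^ k) z \<in> ball \<alpha> \<delta>"
      using funpow_tendsto[OF z] \<delta>(1) by (metis centre_in_ball open_ball topological_tendstoD)
    then obtain k0 where k0: "(\<phi> ^^ k0) z \<in> ball \<alpha> \<delta>"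
      using eventually_happens by fastforce
    have "open ((\<phi> ^^ k0) -` ball \<alpha> \<delta> \<inter> \<D>)"
      using funpow_holomorphic holomorphic_on_imp_continuous_on
      by (metis continuous_on_open_vimage open_ball)
    with k0 z obtain d where d: "0 < d" "cball z d \<subseteq> (\<phi> ^^ k0) -` ball \<alpha> \<delta> \<inter> \<D>"
      by (metis IntI open_contains_cball vimageI)
    have "cmod (t k w) \<le> ((\<delta> / \<rho> ^ k0) ^ N * B / cmod \<mu>) * a k" if "k \<ge> k0" "w \<in> cball z d" for k w
    proof -
      let ?y = "(\<phi> ^^ k) w"
      have "(\<phi> ^^ k0) w \<in> cball \<alpha> \<delta>"
        using d(2) that(2) ball_subset_cball by blast
      moreover have "?y = (\<phi> ^^ (k - k0)) ((\<phi> ^^ k0) w)"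
        using that(1) by (metis comp_apply funpow_add le_add_diff_inverse2)
      ultimately have y: "?y \<in> cball \<alpha> \<delta>" "cmod (?y - \<alpha>) \<le> \<rho> ^ (k - k0) * \<delta>"
        using contract by auto
      have "cmod (g ?y) \<le> (\<rho> ^ (k - k0) * \<delta>) ^ N * B"
        unfolding g_def norm_mult norm_power using y B \<rho>0 \<delta>(1)
        by (intro mult_mono power_mono) auto
      also have "\<rho> ^ (k - k0) * \<delta> = \<rho> ^ k * (\<delta> / \<rho> ^ k0)"
        using that(1) \<rho>0 by (simp add: power_diff)
      also have "(\<rho> ^ k * (\<delta> / \<rho> ^ k0)) ^ N * B = (\<rho> ^ N) ^ k * ((\<delta> / \<rho> ^ k0) ^ N * B)"
        by (simp only: power_mult_distrib mult.assoc mult.commute[of k N] flip: power_mult)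
      finally have "cmod (g ?y) / cmod \<mu> ^ Suc k
          \<le> (\<rho> ^ N) ^ k * ((\<delta> / \<rho> ^ k0) ^ N * B) / cmod \<mu> ^ Suc k"
        by (rule divide_right_mono) simp
      also have "\<dots> = ((\<delta> / \<rho> ^ k0) ^ N * B / cmod \<mu>) * a k"
        by (simp add: a_def power_divide mult_ac)
      finally show ?thesis
        unfolding t_def norm_divide norm_power .
    qed
    with d show ?thesis by blast
  qed
  have lim: "\<exists>d>0. cball z d \<subseteq> \<D> \<and> uniform_limit (cball z d) (\<lambda>n w. \<Sum>k<n. t k w) f sequentially"
    if z: "z \<in> \<D>" for z
  proof -
    obtain d C k0 where d: "0 < d" "cball z d \<subseteq> \<D>"
      "\<And>k w. k \<ge> k0 \<Longrightarrow> w \<in> cball z d \<Longrightarrow> cmod (t k w) \<le> C * a k"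
      using local_bound[OF z] by meson
    have "uniform_limit (cball z d) (\<lambda>n w. \<Sum>k<n. t k w) (\<lambda>w. \<Sum>k. t k w) sequentially"
    proof (rule Weierstrass_m_test_ev)
      show "\<forall>\<^sub>F k in sequentially. \<forall>w\<in>cball z d. cmod (t k w) \<le> C * a k"
        using d(3) by (auto simp: eventually_sequentially simp del: mem_cball)
      show "summable (\<lambda>k. C * a k)"
        using \<open>summable a\<close> by (rule summable_mult)
    qed
    with d show ?thesis unfolding f_def by blast
  qed
  have "f holomorphic_on \<D>"
  proof (rule holomorphic_uniform_sequence)
    show "(\<lambda>w. \<Sum>k<n. t k w) holomorphic_on \<D>" for n
      by (intro holomorphic_intros hol_t)
  qed (use lim in auto)
  moreover have "\<mu> * f z - f (\<phi> z) = g z" if z: "z \<in> \<D>" for z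
  proof -
    obtain d where "0 < d" "uniform_limit (cball z d) (\<lambda>n w. \<Sum>k<n. t k w) f sequentially"
      using lim[OF z] by blast
    then have "(\<lambda>n. \<Sum>k<n. t k z) \<longlonglongrightarrow> f z"
      by (intro tendsto_uniform_limitI) auto
    then have sums: "(\<lambda>k. t k z) sums f z" by (simp add: sums_def)
    then have "(\<lambda>k. t (Suc k) z) sums (f z - t 0 z)"
      using sums_Suc_iff[of "\<lambda>k. t k z"] by simp
    then have "(\<lambda>k. \<mu> * t (Suc k) z) sums (\<mu> * (f z - t 0 z))"
      by (rule sums_mult)
    \<comment> \<open>Composing with \<phi> shifts the series by one index, so \<mu> f - f \<circ>
      \<phi> leaves only the initial term \<mu> t 0 = g.\<close>
    moreover have "\<mu> * t (Suc k) z = t k (\<phi> z)" for k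
      using \<mu>0 by (simp add: t_def funpow_swap1)
    ultimately have "f (\<phi> z) = \<mu> * (f z - t 0 z)"
      unfolding f_def by (simp add: sums_iff)
    moreover have "\<mu> * t 0 z = g z"
      using \<mu>0 by (simp add: t_def)
    ultimately show ?thesis by (simp add: algebra_simps)
  qed
  ultimately show ?thesis using that by (simp add: g_def)
qed

text \<open>With \<rho> between |\<open>deriv \<phi> \<alpha>\<close>| and 1, N is taken so large
  that \<rho>^N < |\<mu>|, possible as \<mu> \<noteq> 0. The solution is p from
  \<open>solve_modulo_order\<close> plus the Neumann series for the remainder.\<close>

lemma resolvent_surj:
  assumes g: "g holomorphic_on \<D>" and "\<mu> \<noteq> 0" and "\<And>n. \<mu> \<noteq> deriv \<phi> \<alpha> ^ n"
  obtains f where "f holomorphic_on \<D>" "\<And>z. z \<in> \<D> \<Longrightarrow> \<mu> * f z - f (\<phi> z) = g z"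
proof -
  obtain \<rho> where \<rho>: "cmod (deriv \<phi> \<alpha>) < \<rho>" "\<rho> < 1"
    using deriv_less dense by blast
  then obtain N where N: "\<rho> ^ N < cmod \<mu>"
    using real_arch_pow_inv[of "cmod \<mu>" \<rho>] assms(2) by auto
  obtain p h where ph: "p holomorphic_on \<D>" "h holomorphic_on \<D>"
    "\<And>z. z \<in> \<D> \<Longrightarrow> g z = \<mu> * p z - p (\<phi> z) + (z - \<alpha>) ^ N * h z"
    using solve_modulo_order[OF g assms(3), where N = N] by blast
  obtain f where f: "f holomorphic_on \<D>"
    "\<And>z. z \<in> \<D> \<Longrightarrow> \<mu> * f z - f (\<phi> z) = (z - \<alpha>) ^ N * h z"
    using solve_high_order[OF ph(2) \<rho> N] by blast
  show ?thesis
  proof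
    show "(\<lambda>z. p z + f z) holomorphic_on \<D>"
      by (intro holomorphic_intros ph f)
    show "\<mu> * (p z + f z) - (p (\<phi> z) + f (\<phi> z)) = g z" if "z \<in> \<D>" for z
      using ph(3)[OF that] f(2)[OF that] by (simp add: algebra_simps)
  qed
qed

end

section \<open>Determination of the spectrum\<close>

theorem theorem4p1:
  fixes \<phi> :: "complex \<Rightarrow> complex" and \<alpha> :: complex
  assumes "\<phi> holomorphic_on \<D>"
    and "\<phi> \<in> \<D> \<rightarrow> \<D>"
    and "\<phi> \<notin> Aut_disc"
    and "\<alpha> \<in> \<D>"
    and "\<phi> \<alpha> = \<alpha>"
    and "0 < cmod (deriv \<phi> \<alpha>)"
    and "cmod (deriv \<phi> \<alpha>) < 1"
  shows "spectrum_Hol (composition_op \<phi>) = {0} \<union> {deriv \<phi> \<alpha> ^ n |n :: nat. True}"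
proof -
  interpret disc_fixpoint \<phi> \<alpha>
    using assms by unfold_locales
  have "0 \<in> spectrum_Hol (composition_op \<phi>)"
    using Aut_disc_if_0_notin_spectrum assms(1-3) by blast
  moreover have "deriv \<phi> \<alpha> ^ n \<in> spectrum_Hol (composition_op \<phi>)" for n
  proof (rule ccontr)
    assume "deriv \<phi> \<alpha> ^ n \<notin> spectrum_Hol (composition_op \<phi>)"
    moreover have "(\<lambda>z. (z - \<alpha>) ^ n) holomorphic_on \<D>" by (intro holomorphic_intros)
    ultimately obtain f where "f holomorphic_on \<D>"
      "\<And>z. z \<in> \<D> \<Longrightarrow> deriv \<phi> \<alpha> ^ n * f z - f (\<phi> z) = (z - \<alpha>) ^ n"
      unfolding not_in_spectrum_Hol_iff[OF assms(1,2)] by blast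
    then show False using monomial_not_in_range assms(6) by auto
  qed
  moreover have "\<mu> \<notin> spectrum_Hol (composition_op \<phi>)"
    if "\<mu> \<noteq> 0" "\<And>n. \<mu> \<noteq> deriv \<phi> \<alpha> ^ n" for \<mu>
    unfolding not_in_spectrum_Hol_iff[OF assms(1,2)]
  proof (intro conjI allI impI ballI)
    fix g assume g: "g holomorphic_on \<D>"
    show "\<exists>f. f holomorphic_on \<D> \<and> (\<forall>z\<in>\<D>. \<mu> * f z - f (\<phi> z) = g z)"
      by (rule resolvent_surj[of g \<mu>, OF g that]) blast
  next
    fix f z assume f: "f holomorphic_on \<D>" "\<forall>z\<in>\<D>. \<mu> * f z - f (\<phi> z) = 0" and z: "z \<in> \<D>"
    show "f z = 0"
    proof (rule ccontr)
      assume nz: "f z \<noteq> 0"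
      have "\<mu> * f w - f (\<phi> w) = 0" if "w \<in> \<D>" for w
        using f(2) that by blast
      from eigenvalue_power[of f \<mu> z, OF f(1) this z nz] obtain k where "\<mu> = deriv \<phi> \<alpha> ^ k" .
      with that(2) show False by blast
    qed
  qed
  ultimately show ?thesis by blast
qed

end
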